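(* Let $n\geq 2$ and $\delta\geq 1$ be integers, and let $G$ be a connected graph of order $n$ with minimum degree $\delta$. Then $$ABS(G)\leq \delta \sqrt{\frac{n+\delta-3}{n+\delta-1}}+\frac{1}{2}\delta(\delta-1)\sqrt{\frac{n-2}{n-1}}+\delta(n-\delta-1)\sqrt{\frac{2n-5}{2n-3}}+\frac{1}{2}(n-\delta-1)(n-\delta-2)\sqrt{\frac{n-3}{n-2}},$$ with equality if and only if $G\cong D_{n,\delta}$.
   Context: All graphs are finite and simple. For a graph $G$ with vertex degrees $d_v$, the atom-bond sum-connectivity index is $ABS(G)=\sum_{uv\in E(G)}\left(\frac{d_u+d_v-2}{d_u+d_v}\right)^{1/2}$. For $1\le\delta\le n-1$, $D_{n,\delta}$ denotes the graph of order $n$ obtained from the complete graph $K_{n-1}$ by adding a new vertex and joining it to exactly $\delta$ vertices of $K_{n-1}$. In the displayed bound, any term whose integer coefficient is $0$ is read as $0$ (this matters only for $n=2$). *)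

theory Defs
  imports Complex_Main "Graph_Theory.Graph_Theory"
begin

text \<open>
  A finite simple graph is a \<^locale>\<open>pair_graph\<close>: a finite, loop-free, symmetric
  digraph whose arcs are ordered pairs. An undirected edge $uv$ is thus the pair of arcs
  $(u,v)$, $(v,u)$, and the degree of a vertex is its \<^const>\<open>out_degree\<close>.
\<close>

definition uedges :: "'a pair_pre_digraph \<Rightarrow> 'a set set" where
  "uedges G = (\<lambda>(u, v). {u, v}) ` parcs G"

definition min_degree :: "'a pair_pre_digraph \<Rightarrow> nat" where
  "min_degree G = Min (out_degree (with_proj G) ` pverts G)"

text \<open>
  Every undirected edge is counted once. For an edge $e = \{u,v\}$ with $u \neq v$, the sum of
  the degrees over the elements of $e$ is $d_u + d_v$.
\<close>

definition ABS_index :: "'a pair_pre_digraph \<Rightarrow> real" where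
  "ABS_index G = (\<Sum>e \<in> uedges G.
     let s = (\<Sum>v\<in>e. real (out_degree (with_proj G) v)) in sqrt ((s - 2) / s))"

definition complete_graph :: "nat \<Rightarrow> nat pair_pre_digraph" where
  "complete_graph m = \<lparr> pverts = {..<m}, parcs = {(u, v). u < m \<and> v < m \<and> u \<noteq> v} \<rparr>"

text \<open>
  The graph $D_{n,\delta}$, meaningful for $1 \le \delta \le n - 1$: the vertices of $K_{n-1}$
  are $0, \dots, n-2$, the new vertex is $n-1$, and its neighbours are $0, \dots, \delta-1$.
\<close>

definition D_graph :: "nat \<Rightarrow> nat \<Rightarrow> nat pair_pre_digraph" where
  "D_graph n \<delta> =
     \<lparr> pverts = insert (n - 1) (pverts (complete_graph (n - 1))),
       parcs = parcs (complete_graph (n - 1)) \<union> {n - 1} \<times> {..<\<delta>} \<union> {..<\<delta>} \<times> {n - 1} \<rparr>"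

lemma complete_digraph_complete_graph: "complete_digraph m (with_proj (complete_graph m))"
  by (auto simp: complete_digraph_pair_def complete_graph_def)

lemma pair_graph_D_graph:
  assumes "\<delta> \<le> n - 1"
  shows "pair_graph (D_graph n \<delta>)"
proof -
  have sub: "parcs (D_graph n \<delta>) \<subseteq> pverts (D_graph n \<delta>) \<times> pverts (D_graph n \<delta>)"
    and fin: "finite (pverts (D_graph n \<delta>))"
    using assms by (auto simp: D_graph_def complete_graph_def)
  from finite_subset[OF sub] fin have "finite (parcs (D_graph n \<delta>))" by simp
  moreover have "sym (parcs (D_graph n \<delta>))"
    by (auto simp: D_graph_def complete_graph_def sym_def)
  moreover have "fst e \<noteq> snd e" if "e \<in> parcs (D_graph n \<delta>)" for e
    using that assms by (auto simp: D_graph_def complete_graph_def)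
  ultimately show ?thesis
    using sub fin by unfold_locales (auto simp: symmetric_def)
qed

end

theory Submission
  imports Defs
begin

text \<open>
  Map a vertex of minimum degree $\delta$ to the extra vertex of $D_{n,\delta}$ and its neighbours
  to the neighbours of that vertex: this embeds $G$ as a spanning subgraph of $D_{n,\delta}$.
  As $s \mapsto \sqrt{(s-2)/s}$ increases for $s > 0$, inserting edges never lowers the index; it
  raises it strictly when there are no isolated vertices, because then both ends of an inserted
  edge have degree at least $2$, so that the edge has positive weight.
\<close>

section \<open>Edge weights as a function of the degree sum\<close>

definition edge_weight :: "real \<Rightarrow> real" where
  "edge_weight s = sqrt ((s - 2) / s)"

text \<open>Weights sit on ordered pairs, so that subset and reindexing arguments apply directly to
  \<open>parcs\<close>; the price is that every edge counts twice.\<close>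

definition arc_weight :: "'a pair_pre_digraph \<Rightarrow> 'a \<times> 'a \<Rightarrow> real" where
  "arc_weight G e = edge_weight
     (real (out_degree (with_proj G) (fst e)) + real (out_degree (with_proj G) (snd e)))"

text \<open>The radicand is 1 - 2/s. It is negative for s < 2, which does no harm: the real
  \<open>sqrt\<close> is monotone on all of the reals.\<close>

lemma edge_weight_mono:
  assumes "0 < s" "s \<le> t"
  shows "edge_weight s \<le> edge_weight t"
  using assms by (simp add: edge_weight_def field_simps)

lemma edge_weight_nonneg: "2 \<le> s \<Longrightarrow> 0 \<le> edge_weight s"
  by (simp add: edge_weight_def)

lemma edge_weight_pos: "2 < s \<Longrightarrow> 0 < edge_weight s"
  by (simp add: edge_weight_def)

lemma out_degree_with_proj:
  "out_degree (with_proj G) u = card {v. (u, v) \<in> parcs G}"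
proof -
  have "out_arcs (with_proj G) u = Pair u ` {v. (u, v) \<in> parcs G}"
    by (auto simp: out_arcs_def)
  then show ?thesis
    by (simp add: out_degree_def card_image inj_on_def)
qed

section \<open>Symmetric arcs and the double counting of edges\<close>

context pair_graph
begin

lemma parcs_swap: "(u, v) \<in> parcs G \<Longrightarrow> (v, u) \<in> parcs G"
  using arcs_ends_symmetric[OF pair_sym_arcs] by simp

lemma finite_neighbours: "finite {v. (u, v) \<in> parcs G}"
  by (rule finite_subset[OF _ pair_finite_verts]) (auto dest: in_arcsD2)

lemma out_degree_pos:
  assumes "(u, v) \<in> parcs G"
  shows "1 \<le> out_degree (with_proj G) u"
  using assms finite_neighbours[of u]
  by (simp add: out_degree_with_proj Suc_le_eq card_gt_0_iff) blast

lemma arc_weight_nonneg: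
  assumes "e \<in> parcs G"
  shows "0 \<le> arc_weight G e"
proof -
  obtain u v where e: "e = (u, v)" by force
  have "1 \<le> out_degree (with_proj G) u" "1 \<le> out_degree (with_proj G) v"
    using assms parcs_swap[of u v] unfolding e by (blast intro: out_degree_pos)+
  then show ?thesis
    unfolding arc_weight_def e by (intro edge_weight_nonneg) simp
qed

text \<open>Each edge {u, v} has exactly the two preimages (u, v) and (v, u), of equal weight. Later
  arguments reach \<open>ABS_index\<close> through this arc sum.\<close>

lemma sum_arc_weight: "sum (arc_weight G) (parcs G) = 2 * ABS_index G"
proof -
  let ?f = "\<lambda>(u, v). {u, v}"
  have "sum (arc_weight G) (parcs G)
      = (\<Sum>y\<in>?f ` parcs G. sum (arc_weight G) {e \<in> parcs G. ?f e = y})"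
    by (rule sum.image_gen[OF pair_finite_arcs])
  also have "\<dots> = (\<Sum>y\<in>?f ` parcs G.
      2 * (let s = \<Sum>v\<in>y. real (out_degree (with_proj G) v) in sqrt ((s - 2) / s)))"
  proof (rule sum.cong[OF refl], clarify)
    fix u v assume uv: "(u, v) \<in> parcs G"
    then have neq: "u \<noteq> v" by (rule no_loops')
    have "?f e = {u, v} \<longleftrightarrow> e = (u, v) \<or> e = (v, u)" for e
      by (cases e) (simp add: doubleton_eq_iff)
    then have "{e \<in> parcs G. ?f e = {u, v}} = {e \<in> parcs G. e = (u, v) \<or> e = (v, u)}"
      by (simp only:)
    also have "\<dots> = {(u, v), (v, u)}"
      using uv parcs_swap[OF uv] by blast
    finally have fiber: "{e \<in> parcs G. ?f e = {u, v}} = {(u, v), (v, u)}" .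
    show "sum (arc_weight G) {e \<in> parcs G. ?f e = {u, v}}
        = 2 * (let s = \<Sum>w\<in>{u, v}. real (out_degree (with_proj G) w) in sqrt ((s - 2) / s))"
      \<comment> \<open>\<open>neq\<close> keeps the two arcs of the fiber distinct and gives the
        sum over \<open>{u, v}\<close> two terms.\<close>
      unfolding fiber using neq by (simp add: arc_weight_def edge_weight_def Let_def add.commute)
  qed
  finally show ?thesis
    by (simp add: ABS_index_def uedges_def sum_distrib_left)
qed

end

section \<open>Invariance under isomorphism\<close>

lemma ABS_index_digraph_iso:
  assumes "pair_graph G" "pair_graph H" and iso: "digraph_iso (with_proj G) (with_proj H)"
  shows "ABS_index G = ABS_index H"
proof -
  interpret G: pair_graph G by fact
  interpret H: pair_graph H by fact
  from iso obtain f where f: "G.digraph_isomorphism f"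
      and H: "with_proj H = app_iso f (with_proj G)"
    unfolding digraph_iso_def by auto
  have arcs: "parcs H = iso_arcs f ` parcs G"
    using arg_cong[OF H, of arcs] by simp
  \<comment> \<open>The arc map of a digraph isomorphism is a separate function. Comparing the tail
    and head fields, which are projections on both sides, forces it to act as
    \<open>iso_verts f\<close> on each end.\<close>
  have tail: "fst (iso_arcs f e) = iso_verts f (fst e)"
    and head: "snd (iso_arcs f e) = iso_verts f (snd e)" if "e \<in> parcs G" for e
    using G.iso_verts_tail[OF f that] G.iso_verts_head[OF f that]
      arg_cong[OF H, of tail] arg_cong[OF H, of head] by simp_all
  have deg: "out_degree (with_proj H) (iso_verts f u) = out_degree (with_proj G) u"
    if "u \<in> pverts G" for u
    unfolding H by (rule G.out_degree_app_iso_eq[OF f that])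
  have "sum (arc_weight H) (parcs H) = sum (arc_weight H \<circ> iso_arcs f) (parcs G)"
    unfolding arcs by (rule sum.reindex) (rule G.digraph_isomorphism_inj_on_arcs[OF f])
  also have "\<dots> = sum (arc_weight G) (parcs G)"
    by (rule sum.cong)
      (simp_all add: arc_weight_def tail head deg G.arc_fst_in_verts G.arc_snd_in_verts)
  finally show ?thesis
    by (simp add: G.sum_arc_weight H.sum_arc_weight)
qed

section \<open>Monotonicity under insertion of edges\<close>

context
  fixes G H :: "'a pair_pre_digraph"
  assumes G: "pair_graph G" and H: "pair_graph H" and sub: "parcs G \<subseteq> parcs H"
begin

interpretation G: pair_graph G by (rule G)
interpretation H: pair_graph H by (rule H)

lemma out_degree_subgraph_le: "out_degree (with_proj G) u \<le> out_degree (with_proj H) u"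
  unfolding out_degree_with_proj using sub by (intro card_mono H.finite_neighbours) auto

lemma out_degree_subgraph_less:
  assumes "(u, v) \<in> parcs H - parcs G"
  shows "out_degree (with_proj G) u < out_degree (with_proj H) u"
  unfolding out_degree_with_proj using sub assms
  by (intro psubset_card_mono H.finite_neighbours) auto

lemma arc_weight_subgraph_le:
  assumes "e \<in> parcs G"
  shows "arc_weight G e \<le> arc_weight H e"
proof -
  obtain u v where e: "e = (u, v)" by force
  \<comment> \<open>One positive degree makes the degree sum positive, as
    \<open>edge_weight_mono\<close> requires.\<close>
  have "1 \<le> out_degree (with_proj G) u"
    using assms unfolding e by (rule G.out_degree_pos)
  then show ?thesis
    using out_degree_subgraph_le[of u] out_degree_subgraph_le[of v]
    unfolding arc_weight_def e by (intro edge_weight_mono) simp_all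
qed

text \<open>Separates the two effects of inserting edges: new arcs bring their own weight, and old
  arcs gain through larger degrees.\<close>

lemma sum_arc_weight_split:
  "2 * ABS_index H = sum (arc_weight H) (parcs H - parcs G) + sum (arc_weight H) (parcs G)"
  using sum.subset_diff[OF sub H.pair_finite_arcs] by (simp flip: H.sum_arc_weight)

lemma ABS_index_subgraph_le: "ABS_index G \<le> ABS_index H"
proof -
  have "sum (arc_weight G) (parcs G) \<le> sum (arc_weight H) (parcs G)"
    by (rule sum_mono) (rule arc_weight_subgraph_le)
  moreover have "0 \<le> sum (arc_weight H) (parcs H - parcs G)"
    by (rule sum_nonneg) (auto intro: H.arc_weight_nonneg)
  ultimately show ?thesis
    using sum_arc_weight_split G.sum_arc_weight by linarith
qed

text \<open>Inserting a single edge between two isolated vertices would add weight 0, its degree sum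
  being 2; \<open>deg\<close> excludes this.\<close>

lemma ABS_index_subgraph_less:
  assumes deg: "\<And>u. u \<in> pverts H \<Longrightarrow> 1 \<le> out_degree (with_proj G) u"
    and neq: "parcs G \<noteq> parcs H"
  shows "ABS_index G < ABS_index H"
proof -
  obtain u v where uv: "(u, v) \<in> parcs H - parcs G" using neq sub by auto
  \<comment> \<open>The reversed arc is new as well, so the degree grows at both ends.\<close>
  then have vu: "(v, u) \<in> parcs H - parcs G"
    by (auto intro: H.parcs_swap dest: G.parcs_swap)
  have "2 \<le> out_degree (with_proj H) u" "2 \<le> out_degree (with_proj H) v"
    using out_degree_subgraph_less[OF uv] out_degree_subgraph_less[OF vu] deg[of u] deg[of v]
      H.in_arcsD1[of u v] H.in_arcsD2[of u v] uv by auto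
  then have "0 < arc_weight H (u, v)"
    unfolding arc_weight_def by (intro edge_weight_pos) simp
  then have "0 < sum (arc_weight H) (parcs H - parcs G)"
    using uv H.pair_finite_arcs by (intro sum_pos2[of _ "(u, v)"]) (auto intro: H.arc_weight_nonneg)
  moreover have "sum (arc_weight G) (parcs G) \<le> sum (arc_weight H) (parcs G)"
    by (rule sum_mono) (rule arc_weight_subgraph_le)
  ultimately show ?thesis
    using sum_arc_weight_split G.sum_arc_weight by linarith
qed

end

section \<open>The index of D_{n,\<delta>}\<close>

lemma card_off_diagonal:
  assumes "finite A"
  shows "real (card (A \<times> A - Id)) = real (card A) * (real (card A) - 1)"
proof -
  have "A \<times> A - Id = A \<times> A - (\<lambda>x. (x, x)) ` A" by auto
  moreover have "card ((\<lambda>x. (x, x)) ` A) = card A" by (simp add: card_image inj_on_def)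
  ultimately have "card (A \<times> A - Id) = card A * card A - card A"
    using assms by (simp add: card_Diff_subset image_subset_iff card_cartesian_product)
  \<comment> \<open>Without this bound the subtraction on naturals could truncate.\<close>
  moreover have "card A \<le> card A * card A" by simp
  ultimately show ?thesis by (simp add: of_nat_diff algebra_simps)
qed

lemma ABS_index_D_graph:
  assumes n: "2 \<le> n" and \<delta>: "\<delta> \<le> n - 1"
  shows "ABS_index (D_graph n \<delta>) =
           real \<delta> * sqrt ((real n + real \<delta> - 3) / (real n + real \<delta> - 1))
           + 1 / 2 * real \<delta> * (real \<delta> - 1) * sqrt ((real n - 2) / (real n - 1))
           + real \<delta> * (real n - real \<delta> - 1) * sqrt ((2 * real n - 5) / (2 * real n - 3))
           + 1 / 2 * (real n - real \<delta> - 1) * (real n - real \<delta> - 2)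
               * sqrt ((real n - 3) / (real n - 2))"
proof -
  let ?D = "D_graph n \<delta>"
  interpret D: pair_graph ?D by (rule pair_graph_D_graph[OF \<delta>])
  \<comment> \<open>The extra vertex v, its neighbours A and the other clique vertices B have
    constant degrees \<delta>, n - 1 and n - 2. Each block of arcs between two classes thus
    contributes its size times one weight.\<close>
  define A where "A = {..<\<delta>}"
  define B where "B = {\<delta>..<n - 1}"
  define v where "v = n - 1"
  have fin: "finite A" "finite B" by (simp_all add: A_def B_def)
  have disj: "v \<notin> A" "v \<notin> B" "A \<inter> B = {}" using \<delta> by (auto simp: v_def A_def B_def)
  have card: "real (card A) = real \<delta>" "real (card B) = real n - real \<delta> - 1"
    using n \<delta> by (auto simp: A_def B_def)
  have parcs: "parcs ?D = {v} \<times> A \<union> A \<times> {v} \<union> (A \<times> A - Id) \<union> A \<times> B \<union> B \<times> A \<union> (B \<times> B - Id)"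
    using n \<delta> by (auto simp: D_graph_def complete_graph_def A_def B_def v_def)
  have dv: "real (out_degree (with_proj ?D) v) = real \<delta>"
  proof -
    have "{w. (v, w) \<in> parcs ?D} = A" using disj by (auto simp: parcs)
    then show ?thesis by (simp add: out_degree_with_proj A_def)
  qed
  have dA: "real (out_degree (with_proj ?D) u) = real n - 1" if "u \<in> A" for u
  proof -
    have "{w. (u, w) \<in> parcs ?D} = {..<n} - {u}"
      using that n \<delta> by (auto simp: D_graph_def complete_graph_def A_def)
    then show ?thesis using that n \<delta> by (simp add: out_degree_with_proj A_def of_nat_diff)
  qed
  have dB: "real (out_degree (with_proj ?D) u) = real n - 2" if "u \<in> B" for u
  proof -
    have "{w. (u, w) \<in> parcs ?D} = {..<n - 1} - {u}"
      using that n \<delta> by (auto simp: D_graph_def complete_graph_def B_def)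
    then show ?thesis using that n \<delta> by (simp add: out_degree_with_proj B_def of_nat_diff)
  qed
  have s1: "sum (arc_weight ?D) ({v} \<times> A) = real \<delta> * edge_weight (real n + real \<delta> - 1)"
    (is "?S1 = _")
  proof -
    have "?S1 = (\<Sum>e\<in>{v} \<times> A. edge_weight (real n + real \<delta> - 1))"
      by (intro sum.cong) (auto simp: arc_weight_def dv dA algebra_simps)
    then show ?thesis by (simp add: card card_cartesian_product)
  qed
  have s2: "sum (arc_weight ?D) (A \<times> {v}) = real \<delta> * edge_weight (real n + real \<delta> - 1)"
    (is "?S2 = _")
  proof -
    have "?S2 = (\<Sum>e\<in>A \<times> {v}. edge_weight (real n + real \<delta> - 1))"
      by (intro sum.cong) (auto simp: arc_weight_def dv dA algebra_simps)
    then show ?thesis by (simp add: card card_cartesian_product)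
  qed
  have s3: "sum (arc_weight ?D) (A \<times> A - Id)
      = real \<delta> * (real \<delta> - 1) * edge_weight (2 * (real n - 1))" (is "?S3 = _")
  proof -
    have "?S3 = (\<Sum>e\<in>A \<times> A - Id. edge_weight (2 * (real n - 1)))"
      by (intro sum.cong) (auto simp: arc_weight_def dA algebra_simps)
    then show ?thesis by (simp add: card card_off_diagonal fin)
  qed
  have s4: "sum (arc_weight ?D) (A \<times> B)
      = real \<delta> * (real n - real \<delta> - 1) * edge_weight (2 * real n - 3)" (is "?S4 = _")
  proof -
    have "?S4 = (\<Sum>e\<in>A \<times> B. edge_weight (2 * real n - 3))"
      by (intro sum.cong) (auto simp: arc_weight_def dA dB algebra_simps)
    then show ?thesis by (simp add: card card_cartesian_product)
  qed
  have s5: "sum (arc_weight ?D) (B \<times> A)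
      = real \<delta> * (real n - real \<delta> - 1) * edge_weight (2 * real n - 3)" (is "?S5 = _")
  proof -
    have "?S5 = (\<Sum>e\<in>B \<times> A. edge_weight (2 * real n - 3))"
      by (intro sum.cong) (auto simp: arc_weight_def dA dB algebra_simps)
    then show ?thesis by (simp add: card card_cartesian_product)
  qed
  have s6: "sum (arc_weight ?D) (B \<times> B - Id)
      = (real n - real \<delta> - 1) * (real n - real \<delta> - 2) * edge_weight (2 * (real n - 2))"
    (is "?S6 = _")
  proof -
    have "?S6 = (\<Sum>e\<in>B \<times> B - Id. edge_weight (2 * (real n - 2)))"
      by (intro sum.cong) (auto simp: arc_weight_def dB algebra_simps)
    then show ?thesis by (simp add: card card_off_diagonal fin)
  qed
  have "2 * ABS_index ?D = ?S1 + ?S2 + ?S3 + ?S4 + ?S5 + ?S6"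
    unfolding D.sum_arc_weight[symmetric] parcs using fin disj
    by (subst sum.union_disjoint; auto)+
  \<comment> \<open>Halving merges the mirrored blocks (v with A, A with B) and leaves the factor
    1/2 on the arcs inside A and inside B.\<close>
  then have total: "ABS_index ?D =
      real \<delta> * edge_weight (real n + real \<delta> - 1)
      + 1 / 2 * real \<delta> * (real \<delta> - 1) * edge_weight (2 * (real n - 1))
      + real \<delta> * (real n - real \<delta> - 1) * edge_weight (2 * real n - 3)
      + 1 / 2 * (real n - real \<delta> - 1) * (real n - real \<delta> - 2)
          * edge_weight (2 * (real n - 2))"
    unfolding s1 s2 s3 s4 s5 s6 by (simp add: field_simps)
  \<comment> \<open>This also holds at t = 0, where division by zero gives 0 on both sides; t = n -
    2 takes that value when n = 2.\<close>
  have double: "edge_weight (2 * t) = sqrt ((t - 1) / t)" for t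
  proof -
    have "(2 * t - 2) / (2 * t) = (2 * (t - 1)) / (2 * t)" by simp
    then show ?thesis unfolding edge_weight_def by (simp only: mult_divide_mult_cancel_left_if) simp
  qed
  show ?thesis
    unfolding total double by (simp add: edge_weight_def)
qed

section \<open>Relabelling the vertices of a graph\<close>

lemma pair_graph_map:
  assumes "pair_graph G" and inj: "inj_on f (pverts G)"
  shows "pair_graph \<lparr>pverts = f ` pverts G, parcs = map_prod f f ` parcs G\<rparr>" (is "pair_graph ?H")
    and "digraph_iso (with_proj G) (with_proj \<lparr>pverts = f ` pverts G, parcs = map_prod f f ` parcs G\<rparr>)"
proof -
  interpret G: pair_graph G by fact
  have "f u \<noteq> f v" if "(u, v) \<in> parcs G" for u v
    using G.no_loops'[OF that] G.wellformed'[OF that] inj by (auto dest: inj_onD)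
  moreover have "sym (map_prod f f ` parcs G)"
    by (force intro: symI dest: G.parcs_swap)
  ultimately show "pair_graph ?H"
    using G.pair_finite_verts G.pair_finite_arcs
    by unfold_locales (auto simp: symmetric_def dest: G.wellformed')
  have "parcs G \<subseteq> pverts G \<times> pverts G" by (auto dest: G.wellformed')
  then have "inj_on (map_prod f f) (parcs G)"
    using map_prod_inj_on[OF inj inj] by (rule inj_on_subset[rotated])
  \<comment> \<open>The head and tail maps of the witness are the projections, so that the image
    again has the form \<open>with_proj\<close>.\<close>
  then show "digraph_iso (with_proj G) (with_proj ?H)"
    unfolding digraph_iso_def G.digraph_isomorphism_def using inj G.wf_digraph_axioms
    by (intro exI[of _ "\<lparr>iso_verts = f, iso_arcs = map_prod f f, iso_head = snd, iso_tail = fst\<rparr>"])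
      (auto simp: app_iso_def with_proj_def)
qed

text \<open>The targets follow the numbering of \<open>D_graph\<close>: the neighbours N of v come
  first and v comes last. Bijections on N, on the remaining vertices and on {v} are glued
  together.\<close>

lemma ex_bij_betw_D_graph:
  assumes "finite V" "v \<in> V" "N \<subseteq> V - {v}"
  obtains f where "bij_betw f V {..<card V}" "f v = card V - 1" "f ` N = {..<card N}"
proof -
  have fin: "finite N" "finite (V - {v} - N)" using assms finite_subset by auto
  have le: "card N \<le> card V - 1" using assms card_mono[of "V - {v}" N] by simp
  have V: "card V > 0" using assms card_gt_0_iff by blast
  obtain g where g: "bij_betw g N {..<card N}"
    using finite_same_card_bij[OF fin(1), of "{..<card N}"] by auto
  have "card (V - {v} - N) = card {card N..<card V - 1}"
    using assms fin by (simp add: card_Diff_subset)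
  then obtain h where h: "bij_betw h (V - {v} - N) {card N..<card V - 1}"
    using finite_same_card_bij[OF fin(2), of "{card N..<card V - 1}"] by auto
  define f where "f x = (if x = v then card V - 1 else if x \<in> N then g x else h x)" for x
  have fN: "bij_betw f N {..<card N}"
    using g assms by (subst bij_betw_cong[of _ _ g]) (auto simp: f_def)
  moreover have "bij_betw f (V - {v} - N) {card N..<card V - 1}"
    using h by (subst bij_betw_cong[of _ _ h]) (auto simp: f_def)
  moreover have "bij_betw f {v} {card V - 1}"
    by (simp add: f_def bij_betw_def)
  \<comment> \<open>\<open>le\<close> keeps the last index out of the range used for N, so the three
    targets are disjoint.\<close>
  ultimately have "bij_betw f (N \<union> (V - {v} - N) \<union> {v})
      ({..<card N} \<union> {card N..<card V - 1} \<union> {card V - 1})"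
    using le by (intro bij_betw_combine) auto
  moreover have "N \<union> (V - {v} - N) \<union> {v} = V" using assms by auto
  moreover have "{..<card N} \<union> {card N..<card V - 1} \<union> {card V - 1} = {..<card V}"
    using le V by auto
  ultimately have "bij_betw f V {..<card V}" by simp
  with fN show ?thesis
    by (intro that[of f]) (auto simp: f_def bij_betw_def)
qed

section \<open>Embedding into D_{n,\<delta>} and the equality case\<close>

theorem theorem1:
  fixes n \<delta> :: nat
    and G :: "'a pair_pre_digraph"
  assumes "n \<ge> 2" and "\<delta> \<ge> 1"
    and "pair_graph G"
    and "Digraph_Component.connected (with_proj G)"
    and "card (pverts G) = n"
    and "min_degree G = \<delta>"
  shows "let B =
           real \<delta> * sqrt ((real n + real \<delta> - 3) / (real n + real \<delta> - 1))
           + 1 / 2 * real \<delta> * (real \<delta> - 1) * sqrt ((real n - 2) / (real n - 1))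
           + real \<delta> * (real n - real \<delta> - 1) * sqrt ((2 * real n - 5) / (2 * real n - 3))
           + 1 / 2 * (real n - real \<delta> - 1) * (real n - real \<delta> - 2)
               * sqrt ((real n - 3) / (real n - 2))
         in ABS_index G \<le> B \<and>
            (ABS_index G = B \<longleftrightarrow> digraph_iso (with_proj G) (with_proj (D_graph n \<delta>)))"
proof -
  interpret G: pair_graph G by fact
  let ?d = "out_degree (with_proj G)" and ?D = "D_graph n \<delta>"
  have ne: "pverts G \<noteq> {}" using assms by auto
  have "\<delta> \<in> ?d ` pverts G"
    using assms(6) ne Min_in[of "?d ` pverts G"] G.pair_finite_verts by (auto simp: min_degree_def)
  then obtain v where v: "v \<in> pverts G" "?d v = \<delta>" by auto
  have deg: "1 \<le> ?d u" if "u \<in> pverts G" for u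
    using assms(2,6) that G.pair_finite_verts Min_le[of "?d ` pverts G" "?d u"]
    by (auto simp: min_degree_def)
  define N where "N = {u. (v, u) \<in> parcs G}"
  have N: "N \<subseteq> pverts G - {v}" "card N = \<delta>"
    using v by (auto simp: N_def out_degree_with_proj dest: G.in_arcsD2 G.no_loops')
  \<comment> \<open>The \<delta> neighbours of v lie among the n - 1 other vertices.\<close>
  have \<delta>: "\<delta> \<le> n - 1"
    using card_mono[OF _ N(1)] N(2) v assms(5) G.pair_finite_verts by simp
  interpret D: pair_graph ?D by (rule pair_graph_D_graph[OF \<delta>])
  obtain f where f: "bij_betw f (pverts G) {..<n}" "f v = n - 1" "f ` N = {..<\<delta>}"
    using ex_bij_betw_D_graph[OF G.pair_finite_verts v(1) N(1)] N(2) assms(5) by metis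
  then have inj: "inj_on f (pverts G)" and img: "f ` pverts G = {..<n}"
    by (auto simp: bij_betw_def)
  define H where "H = \<lparr>pverts = f ` pverts G, parcs = map_prod f f ` parcs G\<rparr>"
  note H = pair_graph_map[OF assms(3) inj, folded H_def]
  interpret H: pair_graph H by (rule H(1))
  have GH: "ABS_index G = ABS_index H" by (rule ABS_index_digraph_iso[OF assms(3) H])
  have verts: "pverts H = pverts ?D"
    using assms(1) img by (auto simp: H_def D_graph_def complete_graph_def)
  have pt: "f x < n" "f x = n - 1 \<longleftrightarrow> x = v" if "x \<in> pverts G" for x
    using that img f(2) v(1) inj_onD[OF inj, of x v] by auto
  \<comment> \<open>An arc avoiding v lands between distinct clique vertices. An arc at v joins n -
    1 to a number below \<delta>, since \<open>f\<close> maps N onto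
    \<open>{..<\<delta>}\<close>.\<close>
  have sub: "parcs H \<subseteq> parcs ?D"
  proof -
    have "(f a, f b) \<in> parcs ?D" if ab: "(a, b) \<in> parcs G" for a b
    proof -
      have V: "a \<in> pverts G" "b \<in> pverts G" "a \<noteq> b"
        using ab G.wellformed' G.no_loops' by blast+
      then have "f a \<noteq> f b" using inj by (auto dest: inj_onD)
      moreover have "f b < \<delta>" if "a = v" using that ab f(3) by (auto simp: N_def)
      moreover have "f a < \<delta>" if "b = v"
        using that G.parcs_swap[OF ab] f(3) by (auto simp: N_def)
      ultimately show ?thesis
        using pt[OF V(1)] pt[OF V(2)] by (auto simp: D_graph_def complete_graph_def)
    qed
    then show ?thesis by (auto simp: H_def)
  qed
  \<comment> \<open>The degree hypothesis of \<open>ABS_index_subgraph_less\<close>; it goes back to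
    \<delta> \<ge> 1 through \<open>deg\<close>.\<close>
  have degH: "1 \<le> out_degree (with_proj H) u" if u: "u \<in> pverts ?D" for u
  proof -
    obtain x where x: "x \<in> pverts G" "u = f x" using u verts by (auto simp: H_def)
    obtain y where "(x, y) \<in> parcs G"
      using deg[OF x(1)] G.finite_neighbours[of x]
      by (auto simp: out_degree_with_proj Suc_le_eq card_gt_0_iff)
    then have "(u, f y) \<in> parcs H" using x by (force simp: H_def)
    then show ?thesis by (rule H.out_degree_pos)
  qed
  have le: "ABS_index G \<le> ABS_index ?D"
    unfolding GH by (rule ABS_index_subgraph_le[OF H(1) D.pair_graph_axioms sub])
  have "ABS_index G = ABS_index ?D \<longleftrightarrow> digraph_iso (with_proj G) (with_proj ?D)"
  proof
    assume "ABS_index G = ABS_index ?D"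
    \<comment> \<open>A missing edge would make the index strictly smaller. Hence H is
      D_{n,\<delta>} itself, and the relabelling \<open>f\<close> is the isomorphism.\<close>
    then have "parcs H = parcs ?D"
      using ABS_index_subgraph_less[OF H(1) D.pair_graph_axioms sub degH] GH by auto
    with verts have "H = ?D" by simp
    with H(2) show "digraph_iso (with_proj G) (with_proj ?D)" by simp
  next
    assume "digraph_iso (with_proj G) (with_proj ?D)"
    then show "ABS_index G = ABS_index ?D"
      by (rule ABS_index_digraph_iso[OF assms(3) D.pair_graph_axioms])
  qed
  with le show ?thesis
    unfolding Let_def ABS_index_D_graph[OF assms(1) \<delta>] by blast
qed

end
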